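(* Let $D, M \ge 1$, let $b_{j,1},\dots,b_{j,M} \in \mathbb{R}^D$, let $R_j \in \mathbb{R}^{D\times r}$ be a matrix whose columns form an orthonormal basis of $\mathrm{span}\{b_{j,1},\dots,b_{j,M}\}$, and let $\mathrm{span}(R_j)$ denote the column space of $R_j$. Let $t_j \in \mathbb{R}^D$ be such that $$t_j^\perp = (I_D - R_j R_j^\top)\, t_j \neq 0 .$$ Then every $w \in \mathrm{span}(R_j)$ is left unchanged by the hard-projection erasure update, i.e. $$w - \delta\big(\cos(t_j, w)\big)\,\frac{\langle t_j^\perp, w\rangle}{\langle t_j^\perp, t_j^\perp\rangle}\, t_j^\perp = w .$$
   Context: $\langle\cdot,\cdot\rangle$ is the standard Euclidean inner product on $\mathbb{R}^D$, $\|\cdot\|$ its norm, and $I_D$ the $D\times D$ identity matrix. The cosine similarity is $\cos(t,v) = \langle t,v\rangle/(\|t\|\,\|v\|)$ (set to $0$ if $t$ or $v$ is zero). The gate is the function $\delta(x) = \dfrac{s}{1+\exp\{-p(x-\epsilon)\}}$ with fixed real parameters $s, p, \epsilon$. The hard-projection erasure update sends a value vector $v \in \mathbb{R}^D$ to $v - \delta(\cos(t_j,v))\,\frac{\langle t_j^\perp, v\rangle}{\langle t_j^\perp, t_j^\perp\rangle}\, t_j^\perp$. The vectors $b_{j,m}$ are called retained anchors and $t_j$ the target value vector; the subscript $j$ is a fixed index and plays no role. *)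

theory Defs
  imports Complex_Main "Jordan_Normal_Form.VS_Connect"
begin

text \<open>Vectors and matrices carry their dimensions as terms, so that the number of columns of
  a matrix may be zero: this is the basis of the zero space, which is the span of the anchors
  when all of them vanish.\<close>

definition vec_norm :: "real vec \<Rightarrow> real" where
  "vec_norm v = sqrt (v \<bullet> v)"

definition cosine_similarity :: "real vec \<Rightarrow> real vec \<Rightarrow> real" where
  "cosine_similarity t v =
     (if t = 0\<^sub>v (dim_vec t) \<or> v = 0\<^sub>v (dim_vec v) then 0
      else (t \<bullet> v) / (vec_norm t * vec_norm v))"

definition gate :: "real \<Rightarrow> real \<Rightarrow> real \<Rightarrow> real \<Rightarrow> real" where
  "gate s p \<epsilon> x = s / (1 + exp (- (p * (x - \<epsilon>))))"

definition orthonormal_basis_columns :: "nat \<Rightarrow> nat \<Rightarrow> real mat \<Rightarrow> real vec set \<Rightarrow> bool" where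
  "orthonormal_basis_columns D r R S \<longleftrightarrow>
     R \<in> carrier_mat D r \<and>
     (\<forall>i<r. \<forall>k<r. col R i \<bullet> col R k = (if i = k then 1 else 0)) \<and>
     \<not> LinearCombinations.module.lin_dep class_ring (module_vec TYPE(real) D) (set (cols R)) \<and>
     LinearCombinations.module.span class_ring (module_vec TYPE(real) D) (set (cols R)) = S"

definition residual_target :: "real mat \<Rightarrow> real vec \<Rightarrow> real vec" where
  "residual_target R t = (1\<^sub>m (dim_row R) - R * R\<^sup>T) *\<^sub>v t"

definition hard_projection_erasure ::
  "real \<Rightarrow> real \<Rightarrow> real \<Rightarrow> real mat \<Rightarrow> real vec \<Rightarrow> real vec \<Rightarrow> real vec" where
  "hard_projection_erasure s p \<epsilon> R t v =
     (let t' = residual_target R t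
      in v - (gate s p \<epsilon> (cosine_similarity t v) * ((t' \<bullet> v) / (t' \<bullet> t'))) \<cdot>\<^sub>v t')"

end

theory Submission
  imports Defs
begin

text \<open>Orthonormal columns give \<open>R\<^sup>T * R = 1\<^sub>m r\<close>, so
  \<open>R * R\<^sup>T\<close> is the orthogonal projection onto the column space of
  \<open>R\<close>, and what it leaves of \<open>t\<close> is orthogonal to that space
  (\<open>residual_target_orthogonal_range\<close>). For \<open>w\<close> in the column space the
  numerator of the erasure coefficient is therefore 0, and the update subtracts the zero
  vector.\<close>

lemma transpose_mult_self_eq_one_mat:
  assumes "orthonormal_basis_columns D r R S"
  shows "R\<^sup>T * R = 1\<^sub>m r"
  using assms by (intro eq_matI) (auto simp: orthonormal_basis_columns_def)

text \<open>Both \<open>t\<close> and its projection have inner product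
  \<open>(R\<^sup>T *\<^sub>v t) \<bullet> x\<close> with \<open>R *\<^sub>v x\<close>, so their
  difference has inner product 0.\<close>

lemma residual_target_orthogonal_range:
  assumes R: "R \<in> carrier_mat D r" and RTR: "R\<^sup>T * R = 1\<^sub>m r"
    and t: "t \<in> carrier_vec D" and x: "x \<in> carrier_vec r"
  shows "residual_target R t \<bullet> (R *\<^sub>v x) = 0"
proof -
  have RT: "R\<^sup>T \<in> carrier_mat r D" and Rx: "R *\<^sub>v x \<in> carrier_vec D"
    and RTt: "R\<^sup>T *\<^sub>v t \<in> carrier_vec r" and P: "R * R\<^sup>T \<in> carrier_mat D D"
    using R t x by auto
  have "residual_target R t = t - R *\<^sub>v (R\<^sup>T *\<^sub>v t)"
    using minus_mult_distrib_mat_vec[OF one_carrier_mat P t] assoc_mult_mat_vec[OF R RT t] R t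
    by (simp add: residual_target_def)
  \<comment> \<open>Moving the left \<open>R\<close> across the inner product produces
    \<open>R\<^sup>T * R\<close>, which cancels.\<close>
  moreover have "(R *\<^sub>v (R\<^sup>T *\<^sub>v t)) \<bullet> (R *\<^sub>v x) = (R\<^sup>T *\<^sub>v t) \<bullet> x"
    using transpose_vec_mult_scalar[OF RT Rx RTt] assoc_mult_mat_vec[OF RT R x, symmetric] RTR x
    by (simp del: assoc_mult_mat_vec)
  moreover have "(R\<^sup>T *\<^sub>v t) \<bullet> x = t \<bullet> (R *\<^sub>v x)"
    by (rule transpose_vec_mult_scalar[OF R x t])
  ultimately show ?thesis
    using minus_scalar_prod_distrib[OF t mult_mat_vec_carrier[OF R RTt] Rx] by simp
qed

theorem corollary1:
  fixes D M r :: nat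
    and b :: "nat \<Rightarrow> real vec"
    and R :: "real mat"
    and t w :: "real vec"
    and s p \<epsilon> :: real
  assumes "D \<ge> 1" and "M \<ge> 1"
    and "\<And>m. m \<in> {1..M} \<Longrightarrow> b m \<in> carrier_vec D"
    and "orthonormal_basis_columns D r R
           (LinearCombinations.module.span class_ring (module_vec TYPE(real) D) (b ` {1..M}))"
    and "t \<in> carrier_vec D"
    and "residual_target R t \<noteq> 0\<^sub>v D"
    and "w \<in> vec_space.col_space D R"
  shows "hard_projection_erasure s p \<epsilon> R t w = w"
proof -
  have R: "R \<in> carrier_mat D r"
    using assms(4) by (simp add: orthonormal_basis_columns_def)
  obtain x where x: "x \<in> carrier_vec r" and w: "w = R *\<^sub>v x"
    using assms(7) R by (auto simp: vec_space.col_space_eq[OF R])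
  \<comment> \<open>A difference of vectors takes the dimension of its second argument, so the final
    comparison with \<open>w\<close> needs both dimensions as well as orthogonality.\<close>
  have "dim_vec (residual_target R t) = D" and "dim_vec w = D"
    using R w by (simp_all add: residual_target_def)
  moreover have "residual_target R t \<bullet> w = 0"
    unfolding w
    by (rule residual_target_orthogonal_range[OF R transpose_mult_self_eq_one_mat[OF assms(4)]
          assms(5) x])
  ultimately show ?thesis
    by (intro eq_vecI) (simp_all add: hard_projection_erasure_def Let_def)
qed

end
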